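(* The following hold for $i\in\{1,2,3\}$: (i) the summands $R_i^\ell\bigl({\rm Ker}(L_i)\cap P_N\bigr)$ $(N,\ell\in\mathbb N)$ in the direct sum $$P=\sum_{N\in\mathbb N}\sum_{\ell\in\mathbb N}R_i^\ell\bigl({\rm Ker}(L_i)\cap P_N\bigr)$$ are mutually orthogonal with respect to $\langle\,,\,\rangle$; (ii) for $N\in\mathbb N$ the summands in the direct sum $$P_N=\sum_{\ell=0}^{\lfloor N/2\rfloor}R_i^\ell\bigl({\rm Ker}(L_i)\cap P_{N-2\ell}\bigr)$$ are mutually orthogonal with respect to $\langle\,,\,\rangle$.
   Context: $\mathbb N=\{0,1,2,\ldots\}$. $P=\mathbb C[x,y,z,w]$; $P_N$ is the subspace of homogeneous polynomials of total degree $N$. $P$ is endowed with the Hermitian form (linear in the first argument, conjugate-symmetric) for which the monomials $x^ry^sz^tw^u$ $(r,s,t,u\in\mathbb N)$ are mutually orthogonal with $\langle x^ry^sz^tw^u,x^ry^sz^tw^u\rangle=r!s!t!u!$. With $D_x,D_y,D_z,D_w$ the partial derivatives, define $L_i,R_i\in{\rm End}(P)$ by $L_1=D_xD_y-D_zD_w$, $L_2=D_xD_z-D_wD_y$, $L_3=D_xD_w-D_yD_z$; $R_1(f)=(xy-zw)f$, $R_2(f)=(xz-wy)f$, $R_3(f)=(xw-yz)f$. The two displayed sums are known to be direct. *)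

theory Defs
  imports Complex_Main "HOL-Library.Poly_Mapping"
begin

section \<open>The polynomial algebra in four variables\<close>

datatype var = X | Y | Z | W

text \<open>A monomial is its exponent map, and a polynomial is a finitely supported map from monomials
  to coefficients. The library's product on \<^typ>\<open>(var \<Rightarrow>\<^sub>0 nat) \<Rightarrow>\<^sub>0 complex\<close> is polynomial
  multiplication, and the scalar \<open>c\<close> is the constant polynomial \<open>single 0 c\<close>.\<close>

type_synonym monom = "var \<Rightarrow>\<^sub>0 nat"
type_synonym cpoly = "monom \<Rightarrow>\<^sub>0 complex"

definition Var :: "var \<Rightarrow> cpoly" where
  "Var v = Poly_Mapping.single (Poly_Mapping.single v 1) 1"

definition mdeg :: "monom \<Rightarrow> nat" where
  "mdeg m = (\<Sum>v\<in>Poly_Mapping.keys m. Poly_Mapping.lookup m v)"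

definition homog :: "nat \<Rightarrow> cpoly set" where
  "homog N = {f. \<forall>m\<in>Poly_Mapping.keys f. mdeg m = N}"

text \<open>The subtraction of exponents is truncated at 0, but then the coefficient vanishes.\<close>

definition pdiff :: "var \<Rightarrow> cpoly \<Rightarrow> cpoly" where
  "pdiff v f = (\<Sum>m\<in>Poly_Mapping.keys f.
     Poly_Mapping.single (m - Poly_Mapping.single v 1)
       (of_nat (Poly_Mapping.lookup m v) * Poly_Mapping.lookup f m))"

text \<open>The sesquilinear extension of the prescribed values on monomials; see the lemmas below.\<close>

definition herm :: "cpoly \<Rightarrow> cpoly \<Rightarrow> complex" where
  "herm f g = (\<Sum>m\<in>Poly_Mapping.keys f.
     Poly_Mapping.lookup f m * cnj (Poly_Mapping.lookup g m) *
     (\<Prod>v\<in>Poly_Mapping.keys m. fact (Poly_Mapping.lookup m v)))"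

section \<open>The operators\<close>

text \<open>Only the indices 1, 2, 3 are meaningful.\<close>

definition L :: "nat \<Rightarrow> cpoly \<Rightarrow> cpoly" where
  "L i f =
    (if i = 1 then pdiff X (pdiff Y f) - pdiff Z (pdiff W f)
     else if i = 2 then pdiff X (pdiff Z f) - pdiff W (pdiff Y f)
     else if i = 3 then pdiff X (pdiff W f) - pdiff Y (pdiff Z f)
     else undefined)"

definition R :: "nat \<Rightarrow> cpoly \<Rightarrow> cpoly" where
  "R i f =
    (if i = 1 then (Var X * Var Y - Var Z * Var W) * f
     else if i = 2 then (Var X * Var Z - Var W * Var Y) * f
     else if i = 3 then (Var X * Var W - Var Y * Var Z) * f
     else undefined)"

definition Ker :: "(cpoly \<Rightarrow> cpoly) \<Rightarrow> cpoly set" where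
  "Ker T = {f. T f = 0}"

definition summand :: "nat \<Rightarrow> nat \<Rightarrow> nat \<Rightarrow> cpoly set" where
  "summand i N l = (R i ^^ l) ` (Ker (L i) \<inter> homog N)"

section \<open>Direct sums and mutual orthogonality of indexed families\<close>

text \<open>The external direct sum of the family \<open>S\<close>, as the finitely supported choices of one element
  from each summand (extended by 0 outside the index set \<open>K\<close>).\<close>

definition families :: "'k set \<Rightarrow> ('k \<Rightarrow> cpoly set) \<Rightarrow> ('k \<Rightarrow> cpoly) set" where
  "families K S = {c. finite {k. c k \<noteq> 0} \<and> (\<forall>k\<in>K. c k \<in> S k) \<and> (\<forall>k. k \<notin> K \<longrightarrow> c k = 0)}"

text \<open>\<open>V\<close> is the internal direct sum of the family \<open>S\<close>: summation is a bijection from the external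
  direct sum onto \<open>V\<close>.\<close>

definition is_direct_sum :: "cpoly set \<Rightarrow> 'k set \<Rightarrow> ('k \<Rightarrow> cpoly set) \<Rightarrow> bool" where
  "is_direct_sum V K S \<longleftrightarrow> bij_betw (\<lambda>c. \<Sum>k | c k \<noteq> 0. c k) (families K S) V"

definition mutually_orthogonal :: "'k set \<Rightarrow> ('k \<Rightarrow> cpoly set) \<Rightarrow> bool" where
  "mutually_orthogonal K S \<longleftrightarrow>
     (\<forall>k\<in>K. \<forall>k'\<in>K. k \<noteq> k' \<longrightarrow> (\<forall>f\<in>S k. \<forall>g\<in>S k'. herm f g = 0))"

section \<open>Characteristic properties of the Hermitian form\<close>

lemma herm_superset:
  assumes "finite A" "Poly_Mapping.keys f \<subseteq> A"
  shows "herm f g = (\<Sum>m\<in>A. Poly_Mapping.lookup f m * cnj (Poly_Mapping.lookup g m) *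
     (\<Prod>v\<in>Poly_Mapping.keys m. fact (Poly_Mapping.lookup m v)))"
  unfolding herm_def using assms
  by (intro sum.mono_neutral_left) (auto simp: in_keys_iff)

lemma herm_add_left: "herm (f + g) h = herm f h + herm g h"
proof -
  let ?A = "Poly_Mapping.keys f \<union> Poly_Mapping.keys g"
  have A: "finite ?A" "Poly_Mapping.keys (f + g) \<subseteq> ?A"
    using Poly_Mapping.keys_add[of f g] by auto
  show ?thesis
    using A herm_superset[OF A] herm_superset[OF A(1), of f h] herm_superset[OF A(1), of g h]
    by (simp add: lookup_add algebra_simps sum.distrib)
qed

lemma herm_scale_left: "herm (Poly_Mapping.single 0 c * f) g = c * herm f g"
proof -
  have l: "Poly_Mapping.lookup (Poly_Mapping.single 0 c * f) m = c * Poly_Mapping.lookup f m" for m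
    by (simp flip: mult_map_scale_conv_mult add: map.rep_eq when_def)
  have k: "Poly_Mapping.keys (Poly_Mapping.single 0 c * f) \<subseteq> Poly_Mapping.keys f"
    by (auto simp: in_keys_iff l)
  show ?thesis
    unfolding herm_superset[OF finite_keys k] by (simp add: herm_def l sum_distrib_left mult.assoc)
qed

lemma herm_cnj: "herm g f = cnj (herm f g)"
proof -
  let ?A = "Poly_Mapping.keys f \<union> Poly_Mapping.keys g"
  show ?thesis
    using herm_superset[of ?A f g] herm_superset[of ?A g f] by (simp add: mult.commute)
qed

lemma Var_powers:
  "Var X ^ r * Var Y ^ s * Var Z ^ t * Var W ^ u =
     Poly_Mapping.single (Poly_Mapping.single X r + Poly_Mapping.single Y s +
       Poly_Mapping.single Z t + Poly_Mapping.single W u) 1"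
proof -
  have "Var v ^ n = Poly_Mapping.single (Poly_Mapping.single v n) 1" for v n
    by (induction n) (simp_all add: Var_def mult_single flip: single_add)
  then show ?thesis
    by (simp add: mult_single)
qed

lemma herm_monomials:
  "herm (Var X ^ r * Var Y ^ s * Var Z ^ t * Var W ^ u) (Var X ^ r' * Var Y ^ s' * Var Z ^ t' * Var W ^ u') =
     (if (r, s, t, u) = (r', s', t', u') then fact r * fact s * fact t * fact u else 0)"
proof -
  define e where "e r s t u = Poly_Mapping.single X r + Poly_Mapping.single Y s +
       Poly_Mapping.single Z t + Poly_Mapping.single W u" for r s t u :: nat
  have le: "Poly_Mapping.lookup (e r s t u) X = r" "Poly_Mapping.lookup (e r s t u) Y = s"
      "Poly_Mapping.lookup (e r s t u) Z = t" "Poly_Mapping.lookup (e r s t u) W = u" for r s t u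
    by (simp_all add: e_def lookup_add lookup_single)
  have eq: "e r s t u = e r' s' t' u' \<longleftrightarrow> (r, s, t, u) = (r', s', t', u')"
    by (metis le prod.inject)
  have all: "v \<in> {X, Y, Z, W}" for v
    by (cases v) auto
  have "(\<Prod>v\<in>Poly_Mapping.keys (e r s t u). fact (Poly_Mapping.lookup (e r s t u) v)) =
      (\<Prod>v\<in>{X, Y, Z, W}. fact (Poly_Mapping.lookup (e r s t u) v) :: complex)"
    by (rule prod.mono_neutral_left) (use all in \<open>auto simp: in_keys_iff\<close>)
  also have "\<dots> = fact r * fact s * fact t * fact u"
    by (simp add: le mult.assoc)
  finally show ?thesis
    unfolding Var_powers e_def[symmetric] using eq
    by (simp add: herm_def lookup_single when_def eq_commute[of "e r' s' t' u'"])
qed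

end

theory Submission
  imports Defs
begin

text \<open>Multiplication by the quadratic form is the adjoint of the second-order operator \<open>L i\<close>, and
  on polynomials of degree \<open>N\<close> the commutator of the two is the scalar \<open>N + 2\<close>. Hence, for \<open>f\<close>
  of degree \<open>N\<close> in the kernel of \<open>L i\<close>, the operator \<open>L i\<close> sends \<open>R i ^^ l\<close> of \<open>f\<close> to \<open>l * (N + l + 1)\<close> times
  \<open>R i ^^ (l - 1)\<close> of \<open>f\<close>. Applying this repeatedly and moving \<open>R i\<close> across the form gives
  orthogonality, which together with positive definiteness gives uniqueness of decompositions.
  Existence follows by induction on the degree: \<open>L i \<circ> R i\<close> acts on every summand of the decomposition
  in degree \<open>N - 2\<close> as a nonzero scalar, so it is onto, and any \<open>f\<close> of degree \<open>N\<close> can be corrected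
  by an element of the image of \<open>R i\<close> to lie in the kernel of \<open>L i\<close>.\<close>

section \<open>Differentiation and multiplication by variables\<close>

lemma UNIV_var: "(UNIV :: var set) = {X, Y, Z, W}"
  using var.exhaust by auto

lemma finite_var [simp]: "finite (A :: var set)"
  by (rule finite_subset[OF subset_UNIV]) (simp add: UNIV_var)

lemma lookup_const_mult:
  "Poly_Mapping.lookup (Poly_Mapping.single 0 c * f) m = c * Poly_Mapping.lookup f (m :: monom)"
  for c :: complex
  by (simp flip: mult_map_scale_conv_mult add: map.rep_eq when_def)

lemma lookup_of_nat_mult:
  "Poly_Mapping.lookup (of_nat n * f) m = of_nat n * Poly_Mapping.lookup (f :: cpoly) m"
  by (metis lookup_const_mult single_of_nat)

lemma minus_single_plus_single:
  "Poly_Mapping.lookup m v \<noteq> 0 \<Longrightarrow> m - Poly_Mapping.single v 1 + Poly_Mapping.single v 1 = (m :: monom)"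
  by (rule poly_mapping_eqI) (auto simp: lookup_add lookup_minus lookup_single when_def)

lemma lookup_pdiff:
  "Poly_Mapping.lookup (pdiff v f) m =
     of_nat (Poly_Mapping.lookup m v + 1) * Poly_Mapping.lookup f (m + Poly_Mapping.single v 1)"
proof -
  let ?e = "Poly_Mapping.single v (1 :: nat)"
  have "Poly_Mapping.lookup (pdiff v f) m =
      (\<Sum>k\<in>Poly_Mapping.keys f. if k - ?e = m
         then of_nat (Poly_Mapping.lookup k v) * Poly_Mapping.lookup f k else 0)"
    by (simp add: pdiff_def lookup_sum lookup_single when_def)
  also have "\<dots> = (\<Sum>k\<in>Poly_Mapping.keys f. if k = m + ?e
         then of_nat (Poly_Mapping.lookup k v) * Poly_Mapping.lookup f k else 0)"
  proof (rule sum.cong)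
    fix k
    \<comment> \<open>If the exponent of \<open>v\<close> in \<open>k\<close> is 0, truncated
      subtraction can give a false match \<open>k - ?e = m\<close>, but then the factor taken from
      that exponent is 0.\<close>
    show "(if k - ?e = m then of_nat (Poly_Mapping.lookup k v) * Poly_Mapping.lookup f k else 0) =
        (if k = m + ?e then of_nat (Poly_Mapping.lookup k v) * Poly_Mapping.lookup f k else 0)"
      using minus_single_plus_single[of k v] by (cases "Poly_Mapping.lookup k v = 0") auto
  qed simp
  finally show ?thesis
    by (auto simp: lookup_add in_keys_iff)
qed

lemma pdiff_add: "pdiff v (f + g) = pdiff v f + pdiff v g"
  by (rule poly_mapping_eqI) (simp add: lookup_pdiff lookup_add algebra_simps)

lemma pdiff_diff: "pdiff v (f - g) = pdiff v f - pdiff v g"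
  by (rule poly_mapping_eqI) (simp add: lookup_pdiff lookup_minus algebra_simps)

lemma pdiff_const_mult:
  "pdiff v (Poly_Mapping.single 0 c * f) = Poly_Mapping.single 0 c * pdiff v f"
  by (rule poly_mapping_eqI) (simp add: lookup_pdiff lookup_const_mult)

lemma lookup_Var_mult:
  "Poly_Mapping.lookup (Var v * f) m =
     (if Poly_Mapping.lookup m v = 0 then 0
      else Poly_Mapping.lookup f (m - Poly_Mapping.single v 1))"
proof -
  let ?e = "Poly_Mapping.single v (1 :: nat)"
  have "Poly_Mapping.lookup (Var v * f) m = Sum_any (\<lambda>k. Poly_Mapping.lookup f k when m = ?e + k)"
    by (simp add: Var_def lookup_mult lookup_single when_mult)
  also have "\<dots> = (if Poly_Mapping.lookup m v = 0 then 0 else Poly_Mapping.lookup f (m - ?e))"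
  proof (cases "Poly_Mapping.lookup m v = 0")
    case True
    then have "m \<noteq> ?e + k" for k
      by (auto simp: lookup_add)
    then show ?thesis
      using True by simp
  next
    case False
    then have "m = ?e + k \<longleftrightarrow> k = m - ?e" for k
      using minus_single_plus_single[of m v] by (metis add.commute add_diff_cancel_left')
    then show ?thesis
      using False by simp
  qed
  finally show ?thesis .
qed

lemma lookup_Var_mult_add:
  "Poly_Mapping.lookup (Var v * f) (m + Poly_Mapping.single v 1) = Poly_Mapping.lookup f m"
  by (simp add: lookup_Var_mult lookup_add)

text \<open>The canonical commutation relation between derivatives and variables, from which the
  commutator of \<open>L i\<close> and \<open>R i\<close> is computed.\<close>

lemma pdiff_Var_mult: "pdiff v (Var u * f) = Var u * pdiff v f + (if u = v then f else 0)"
proof (rule poly_mapping_eqI)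
  fix m
  show "Poly_Mapping.lookup (pdiff v (Var u * f)) m =
      Poly_Mapping.lookup (Var u * pdiff v f + (if u = v then f else 0)) m"
  proof (cases "u = v")
    case True
    then show ?thesis
      using minus_single_plus_single[of m v]
      by (auto simp: lookup_pdiff lookup_add lookup_Var_mult lookup_minus distrib_right)
  next
    case False
    have "m + Poly_Mapping.single v 1 - Poly_Mapping.single u 1 =
        m - Poly_Mapping.single u 1 + Poly_Mapping.single v 1"
      by (rule poly_mapping_eqI)
        (use False in \<open>auto simp: lookup_add lookup_minus lookup_single when_def\<close>)
    then show ?thesis
      using False
      by (auto simp: lookup_pdiff lookup_add lookup_Var_mult lookup_minus lookup_single when_def)
  qed
qed

section \<open>Homogeneous polynomials\<close>

lemma mdeg_eq: "mdeg m = (\<Sum>v\<in>UNIV. Poly_Mapping.lookup m v)"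
  unfolding mdeg_def by (rule sum.mono_neutral_left) (auto simp: in_keys_iff)

lemma mdeg_add_single: "mdeg (m + Poly_Mapping.single v n) = mdeg m + n"
  by (simp add: mdeg_eq lookup_add sum.distrib lookup_single when_def)

lemma homog_iff: "f \<in> homog N \<longleftrightarrow> (\<forall>m. Poly_Mapping.lookup f m \<noteq> 0 \<longrightarrow> mdeg m = N)"
  by (auto simp: homog_def in_keys_iff)

lemma homog_0: "0 \<in> homog N"
  by (simp add: homog_iff)

lemma homog_add: "f \<in> homog N \<Longrightarrow> g \<in> homog N \<Longrightarrow> f + g \<in> homog N"
  unfolding homog_iff lookup_add by (metis add_0)

lemma homog_diff: "f \<in> homog N \<Longrightarrow> g \<in> homog N \<Longrightarrow> f - g \<in> homog N"
  unfolding homog_iff lookup_minus by (metis diff_self)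

lemma homog_sum: "(\<And>k. k \<in> A \<Longrightarrow> F k \<in> homog N) \<Longrightarrow> sum F A \<in> homog N"
  by (induction A rule: infinite_finite_induct) (auto simp: homog_0 homog_add)

lemma homog_const_mult: "f \<in> homog N \<Longrightarrow> Poly_Mapping.single 0 c * f \<in> homog N"
  by (auto simp: homog_iff lookup_const_mult)

lemma homog_Var_mult: "f \<in> homog N \<Longrightarrow> Var v * f \<in> homog (Suc N)"
  unfolding homog_iff
  by (metis lookup_Var_mult minus_single_plus_single mdeg_add_single Suc_eq_plus1)

text \<open>For \<open>N = 0\<close> the derivative is 0, which is homogeneous of every degree, so
  the truncation in \<open>N - 1\<close> is harmless.\<close>

lemma homog_pdiff: "f \<in> homog N \<Longrightarrow> pdiff v f \<in> homog (N - 1)"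
  unfolding homog_iff lookup_pdiff by (metis mdeg_add_single add_diff_cancel_right' mult_zero_right)

lemma pdiff_homog_0: "f \<in> homog 0 \<Longrightarrow> pdiff v f = 0"
  by (rule poly_mapping_eqI) (auto simp: homog_iff lookup_pdiff mdeg_add_single)

text \<open>Each \<open>Var v * pdiff v f\<close> multiplies the coefficient at \<open>m\<close> by
  the exponent of \<open>v\<close>, and the exponents add up to the degree. This turns the
  first-order terms of the commutator into a scalar.\<close>

lemma euler:
  assumes "f \<in> homog N"
  shows "(\<Sum>v\<in>UNIV. Var v * pdiff v f) = of_nat N * f"
proof (rule poly_mapping_eqI)
  fix m
  have "Poly_Mapping.lookup (Var v * pdiff v f) m =
      of_nat (Poly_Mapping.lookup m v) * Poly_Mapping.lookup f m" for v
    using minus_single_plus_single[of m v]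
    by (auto simp: lookup_Var_mult lookup_pdiff lookup_minus)
  then have "Poly_Mapping.lookup (\<Sum>v\<in>UNIV. Var v * pdiff v f) m = of_nat (mdeg m) * Poly_Mapping.lookup f m"
    by (simp add: lookup_sum mdeg_eq flip: sum_distrib_right)
  then show "Poly_Mapping.lookup (\<Sum>v\<in>UNIV. Var v * pdiff v f) m = Poly_Mapping.lookup (of_nat N * f) m"
    using assms by (auto simp: homog_iff lookup_of_nat_mult)
qed

section \<open>The Hermitian form\<close>

lemma prod_fact_eq:
  "(\<Prod>v\<in>Poly_Mapping.keys m. fact (Poly_Mapping.lookup m v)) =
     (\<Prod>v\<in>UNIV. fact (Poly_Mapping.lookup (m :: monom) v) :: complex)"
  by (rule prod.mono_neutral_left) (auto simp: in_keys_iff)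

text \<open>The factor gained by the weight is the one that differentiation produces in
  \<open>lookup_pdiff\<close>; this match yields adjointness.\<close>

lemma prod_fact_add_single:
  "(\<Prod>u\<in>UNIV. fact (Poly_Mapping.lookup ((m :: monom) + Poly_Mapping.single v 1) u) :: complex) =
     of_nat (Poly_Mapping.lookup m v + 1) * (\<Prod>u\<in>UNIV. fact (Poly_Mapping.lookup m u))"
proof -
  have "(\<Prod>u\<in>UNIV. fact (Poly_Mapping.lookup (m + Poly_Mapping.single v 1) u) :: complex) =
      (\<Prod>u\<in>UNIV. (if u = v then of_nat (Poly_Mapping.lookup m v + 1) else 1) *
        fact (Poly_Mapping.lookup m u))"
    by (rule prod.cong) (auto simp: lookup_add lookup_single when_def)
  then show ?thesis
    by (simp add: prod.distrib)
qed

lemma herm_Var_mult: "herm (Var v * f) g = herm f (pdiff v g)"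
proof -
  let ?s = "\<lambda>m :: monom. m + Poly_Mapping.single v 1"
  \<comment> \<open>Every monomial of \<open>Var v * f\<close> is a shifted monomial of
    \<open>f\<close>, so the form can be summed over shifted keys and reindexed by the injective
    shift.\<close>
  have "Poly_Mapping.keys (Var v * f) \<subseteq> ?s ` Poly_Mapping.keys f"
  proof
    fix m
    assume "m \<in> Poly_Mapping.keys (Var v * f)"
    then have "Poly_Mapping.lookup m v \<noteq> 0"
        "Poly_Mapping.lookup f (m - Poly_Mapping.single v 1) \<noteq> 0"
      by (auto simp: in_keys_iff lookup_Var_mult split: if_splits)
    then show "m \<in> ?s ` Poly_Mapping.keys f"
      using minus_single_plus_single[of m v]
      by (intro image_eqI[of _ _ "m - Poly_Mapping.single v 1"]) (auto simp: in_keys_iff)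
  qed
  then have "herm (Var v * f) g = (\<Sum>m\<in>?s ` Poly_Mapping.keys f.
      Poly_Mapping.lookup (Var v * f) m * cnj (Poly_Mapping.lookup g m) *
        (\<Prod>v\<in>UNIV. fact (Poly_Mapping.lookup m v)))"
    by (subst herm_superset) (auto simp: prod_fact_eq)
  also have "\<dots> = (\<Sum>m\<in>Poly_Mapping.keys f. Poly_Mapping.lookup (Var v * f) (?s m) *
        cnj (Poly_Mapping.lookup g (?s m)) * (\<Prod>v\<in>UNIV. fact (Poly_Mapping.lookup (?s m) v)))"
    by (subst sum.reindex) (auto simp: inj_on_def)
  also have "\<dots> = herm f (pdiff v g)"
    unfolding herm_def lookup_Var_mult_add prod_fact_add_single prod_fact_eq lookup_pdiff
    by (simp add: algebra_simps)
  finally show ?thesis .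
qed

lemma herm_0_left [simp]: "herm 0 g = 0"
  by (simp add: herm_def)

lemma herm_0_right [simp]: "herm f 0 = 0"
  by (simp add: herm_def)

lemma herm_diff_left: "herm (f - g) h = herm f h - herm g h"
  using herm_add_left[of "f - g" g h] by simp

lemma herm_diff_right: "herm f (g - h) = herm f g - herm f h"
  by (metis herm_cnj herm_diff_left complex_cnj_diff)

lemma herm_sum_left: "herm (sum F A) g = (\<Sum>k\<in>A. herm (F k) g)"
  by (induction A rule: infinite_finite_induct) (simp_all add: herm_add_left)

lemma herm_definite:
  assumes "herm f f = 0"
  shows "f = 0"
proof (rule ccontr)
  let ?t = "\<lambda>m. (cmod (Poly_Mapping.lookup f m))\<^sup>2 *
    (\<Prod>v\<in>Poly_Mapping.keys m. fact (Poly_Mapping.lookup m v) :: real)"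
  have pos: "?t m > 0" if "m \<in> Poly_Mapping.keys f" for m
    using that by (intro mult_pos_pos prod_pos) (auto simp: in_keys_iff)
  assume "f \<noteq> 0"
  then have "0 < (\<Sum>m\<in>Poly_Mapping.keys f. ?t m)"
    by (intro sum_pos pos) auto
  moreover have "herm f f = of_real (\<Sum>m\<in>Poly_Mapping.keys f. ?t m)"
    unfolding herm_def of_real_sum
    by (intro sum.cong refl) (simp add: complex_norm_square flip: of_real_power)
  ultimately show False
    using assms by (simp del: of_real_sum)
qed

lemma herm_homog:
  assumes "f \<in> homog M" "g \<in> homog N" "M \<noteq> N"
  shows "herm f g = 0"
  unfolding herm_def
proof (rule sum.neutral, rule ballI)
  fix m
  assume "m \<in> Poly_Mapping.keys f"
  then have "Poly_Mapping.lookup g m = 0"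
    using assms by (auto simp: homog_iff in_keys_iff)
  then show "Poly_Mapping.lookup f m * cnj (Poly_Mapping.lookup g m) *
      (\<Prod>v\<in>Poly_Mapping.keys m. fact (Poly_Mapping.lookup m v)) = 0"
    by simp
qed

section \<open>Direct sums of mutually orthogonal families\<close>

text \<open>The image of the summation map; it separates the spanning part of
  \<open>is_direct_sum\<close> from injectivity.\<close>

definition family_sums :: "'k set \<Rightarrow> ('k \<Rightarrow> cpoly set) \<Rightarrow> cpoly set" where
  "family_sums K S = (\<lambda>c. \<Sum>k | c k \<noteq> 0. c k) ` families K S"

lemma family_sums_component:
  assumes "k \<in> K" "f \<in> S k" "\<And>k. k \<in> K \<Longrightarrow> 0 \<in> S k"
  shows "f \<in> family_sums K S"
proof -
  let ?c = "\<lambda>j. if j = k then f else 0"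
  \<comment> \<open>The support is empty, not \<open>{k}\<close>, when \<open>f = 0\<close>.\<close>
  have s: "{j. ?c j \<noteq> 0} = (if f = 0 then {} else {k})"
    by auto
  then have c: "?c \<in> families K S"
    using assms by (auto simp: families_def)
  have "f = (\<Sum>j | ?c j \<noteq> 0. ?c j)"
    unfolding s by simp
  then show ?thesis
    unfolding family_sums_def by (rule image_eqI[where x = ?c]) (rule c)
qed

lemma family_sums_add:
  assumes "f \<in> family_sums K S" "g \<in> family_sums K S"
    and "\<And>k f g. k \<in> K \<Longrightarrow> f \<in> S k \<Longrightarrow> g \<in> S k \<Longrightarrow> f + g \<in> S k"
  shows "f + g \<in> family_sums K S"
proof -
  obtain c d where c: "c \<in> families K S" "f = (\<Sum>k | c k \<noteq> 0. c k)"
    and d: "d \<in> families K S" "g = (\<Sum>k | d k \<noteq> 0. d k)"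
    using assms(1,2) by (auto simp: family_sums_def)
  let ?e = "\<lambda>k. c k + d k"
  \<comment> \<open>Terms of \<open>c\<close> and \<open>d\<close> may cancel, so the three supports
    can differ; all three sums are extended to one common finite set.\<close>
  let ?A = "{k. c k \<noteq> 0} \<union> {k. d k \<noteq> 0}"
  have A: "finite ?A"
    using c d by (auto simp: families_def)
  have "f = sum c ?A" "g = sum d ?A" "(\<Sum>k | ?e k \<noteq> 0. ?e k) = sum ?e ?A"
    unfolding c d by (intro sum.mono_neutral_left A; auto)+
  then have eq: "f + g = (\<Sum>k | ?e k \<noteq> 0. ?e k)"
    by (simp add: sum.distrib)
  have "finite {k. ?e k \<noteq> 0}"
    by (rule finite_subset[OF _ A]) auto
  then have e: "?e \<in> families K S"
    using c d assms(3) by (auto simp: families_def)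
  from eq show ?thesis
    unfolding family_sums_def by (rule image_eqI[where x = ?e]) (rule e)
qed

lemma family_sums_sum:
  assumes "\<And>j. j \<in> J \<Longrightarrow> F j \<in> family_sums K S"
    and "\<And>k f g. k \<in> K \<Longrightarrow> f \<in> S k \<Longrightarrow> g \<in> S k \<Longrightarrow> f + g \<in> S k"
    and "\<And>k. k \<in> K \<Longrightarrow> 0 \<in> S k"
  shows "sum F J \<in> family_sums K S"
proof -
  have zero: "(\<lambda>_. 0) \<in> families K S"
    using assms(3) by (auto simp: families_def)
  have "0 \<in> family_sums K S"
    unfolding family_sums_def by (rule image_eqI[where x = "\<lambda>_. 0"]) (simp, rule zero)
  with assms(1) show ?thesis
    by (induction J rule: infinite_finite_induct) (auto intro: family_sums_add assms(2))
qed

text \<open>Injectivity: if two families have equal sums, pairing the zero sum of their differences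
  with its component at \<open>j\<close> leaves only the diagonal term, which definiteness forces to
  vanish.\<close>

lemma is_direct_sum_orthogonal:
  assumes orth: "mutually_orthogonal K S"
    and diff: "\<And>k f g. k \<in> K \<Longrightarrow> f \<in> S k \<Longrightarrow> g \<in> S k \<Longrightarrow> f - g \<in> S k"
    and V: "family_sums K S = V"
  shows "is_direct_sum V K S"
  unfolding is_direct_sum_def bij_betw_def
proof (intro conjI inj_onI ext)
  show "(\<lambda>c. \<Sum>k | c k \<noteq> 0. c k) ` families K S = V"
    using V by (simp add: family_sums_def)
next
  fix c d j
  assume c: "c \<in> families K S" and d: "d \<in> families K S"
    and eq: "(\<Sum>k | c k \<noteq> 0. c k) = (\<Sum>k | d k \<noteq> 0. d k)"
  let ?e = "\<lambda>k. c k - d k"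
  \<comment> \<open>Inserting \<open>j\<close> guarantees that the diagonal term is present even if
    \<open>c j\<close> and \<open>d j\<close> are both 0.\<close>
  let ?A = "insert j ({k. c k \<noteq> 0} \<union> {k. d k \<noteq> 0})"
  have A: "finite ?A"
    using c d by (auto simp: families_def)
  have "(\<Sum>k | c k \<noteq> 0. c k) = sum c ?A" "(\<Sum>k | d k \<noteq> 0. d k) = sum d ?A"
    by (intro sum.mono_neutral_left A; auto)+
  then have "sum ?e ?A = 0"
    using eq by (simp add: sum_subtractf)
  then have "0 = herm (sum ?e ?A) (?e j)"
    by (simp only: herm_0_left)
  also have "\<dots> = (\<Sum>k\<in>?A. herm (?e k) (?e j))"
    by (rule herm_sum_left)
  also have "\<dots> = (\<Sum>k\<in>?A. if k = j then herm (?e j) (?e j) else 0)"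
  proof (rule sum.cong)
    fix k
    have e: "?e l \<in> S l" if "l \<in> K" for l
      using c d diff that by (auto simp: families_def)
    have e0: "?e l = 0" if "l \<notin> K" for l
      using c d that by (auto simp: families_def)
    show "herm (?e k) (?e j) = (if k = j then herm (?e j) (?e j) else 0)"
    proof (cases "k = j \<or> k \<notin> K \<or> j \<notin> K")
      case True
      then show ?thesis
        using e0 by auto
    next
      case False
      then show ?thesis
        using orth e unfolding mutually_orthogonal_def by metis
    qed
  qed simp
  also have "\<dots> = herm (?e j) (?e j)"
    using A by simp
  finally show "c j = d j"
    using herm_definite[of "?e j"] by simp
qed

section \<open>Raising and lowering operators\<close>

text \<open>Properties shared by the three pairs \<open>L i\<close>, \<open>R i\<close>, so that
  they are treated at once. The scalar \<open>N + 2\<close> is the degree plus half the number of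
  variables. \<open>D_low\<close> is separate because \<open>N - 2\<close> is truncated in degrees 0
  and 1.\<close>

locale raising_lowering =
  fixes D :: "cpoly \<Rightarrow> cpoly" and q :: cpoly
  assumes D_add: "D (f + g) = D f + D g"
    and D_const_mult: "D (Poly_Mapping.single 0 c * f) = Poly_Mapping.single 0 c * D f"
    and adjoint: "herm (q * f) g = herm f (D g)"
    and commutator: "f \<in> homog N \<Longrightarrow> D (q * f) = q * D f + of_nat (N + 2) * f"
    and homog_q_mult: "f \<in> homog N \<Longrightarrow> q * f \<in> homog (N + 2)"
    and homog_D: "f \<in> homog N \<Longrightarrow> D f \<in> homog (N - 2)"
    and D_low: "f \<in> homog N \<Longrightarrow> N < 2 \<Longrightarrow> D f = 0"
begin

section \<open>Powers of the quadratic form and orthogonality\<close>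

lemma D_0 [simp]: "D 0 = 0"
  using D_add[of 0 0] by simp

lemma D_diff: "D (f - g) = D f - D g"
  using D_add[of "f - g" g] by (simp add: algebra_simps)

lemma D_of_nat_mult: "D (of_nat n * f) = of_nat n * D f"
  by (metis D_const_mult single_of_nat)

lemma D_sum: "D (sum F A) = (\<Sum>k\<in>A. D (F k))"
  by (induction A rule: infinite_finite_induct) (simp_all add: D_add)

lemma funpow_D_of_nat_mult: "(D ^^ n) (of_nat k * f) = of_nat k * (D ^^ n) f"
  by (induction n) (simp_all add: D_of_nat_mult)

lemma homog_power_mult: "f \<in> homog N \<Longrightarrow> q ^ l * f \<in> homog (N + 2 * l)"
proof (induction l)
  case (Suc l)
  then show ?case
    using homog_q_mult[of "q ^ l * f" "N + 2 * l"] by (simp add: mult.assoc)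
qed simp

text \<open>Moving \<open>D\<close> past the factors \<open>q\<close> one at a time collects the
  scalars \<open>N + 2 * j + 2\<close> for \<open>j \<le> l\<close>, whose sum is
  \<open>(l + 1) * (N + l + 2)\<close>.\<close>

lemma D_power_mult:
  assumes "D f = 0" "f \<in> homog N"
  shows "D (q ^ Suc l * f) = of_nat (Suc l * (N + l + 2)) * (q ^ l * f)"
proof (induction l)
  case 0
  then show ?case
    using commutator[OF assms(2)] assms(1) by simp
next
  case (Suc l)
  have "D (q ^ Suc (Suc l) * f) = q * D (q ^ Suc l * f) + of_nat (N + 2 * Suc l + 2) * (q ^ Suc l * f)"
    using commutator[OF homog_power_mult[OF assms(2), of "Suc l"]] by (simp only: power_Suc mult.assoc)
  also have "\<dots> = (of_nat (Suc l * (N + l + 2)) + of_nat (N + 2 * Suc l + 2)) * (q ^ Suc l * f)"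
    unfolding Suc by (simp only: power_Suc algebra_simps)
  also have "\<dots> = of_nat (Suc (Suc l) * (N + Suc l + 2)) * (q ^ Suc l * f)"
    unfolding of_nat_add[symmetric] by (rule arg_cong[where f = "\<lambda>n. of_nat n * _"]) simp
  finally show ?case .
qed

text \<open>Each of the first \<open>l\<close> applications of \<open>D\<close> strips one factor
  \<open>q\<close>, up to a scalar, and the next one meets \<open>f\<close> in the kernel.\<close>

lemma funpow_D_power_mult:
  assumes "D f = 0" "f \<in> homog N" "l < n"
  shows "(D ^^ n) (q ^ l * f) = 0"
  using assms(3)
proof (induction l arbitrary: n)
  case 0
  then show ?case
    \<comment> \<open>The instance with scalar 0 says that powers of \<open>D\<close> fix 0.\<close>
    using assms(1) by (cases n) (auto simp: funpow_swap1 funpow_D_of_nat_mult[of _ 0, simplified])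
next
  case (Suc l)
  then obtain k where k: "n = Suc k" "l < k"
    by (cases n) auto
  have "(D ^^ n) (q ^ Suc l * f) = (D ^^ k) (D (q ^ Suc l * f))"
    by (simp only: k funpow_Suc_right o_apply)
  then show ?case
    unfolding D_power_mult[OF assms(1,2)] funpow_D_of_nat_mult using Suc.IH[OF k(2)] by simp
qed

lemma adjoint_power: "herm (q ^ n * f) g = herm f ((D ^^ n) g)"
  by (induction n arbitrary: g) (simp_all add: mult.assoc adjoint funpow_swap1)

text \<open>The higher power of \<open>q\<close> is moved across the form, where it becomes more
  applications of \<open>D\<close> than there are factors \<open>q\<close> left. If
  \<open>k = l\<close> then \<open>M \<noteq> N\<close>, so the total degrees differ and no monomial
  is shared.\<close>

lemma orthogonal:
  assumes f: "D f = 0" "f \<in> homog M" and g: "D g = 0" "g \<in> homog N"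
    and "(M, k) \<noteq> (N, l)"
  shows "herm (q ^ k * f) (q ^ l * g) = 0"
proof -
  consider "k < l" | "l < k" | "M + 2 * k \<noteq> N + 2 * l"
    using assms(5) by fastforce
  then show ?thesis
  proof cases
    case 1
    then have "herm (q ^ l * g) (q ^ k * f) = 0"
      by (simp add: adjoint_power funpow_D_power_mult[OF f])
    then show ?thesis
      by (metis herm_cnj complex_cnj_zero)
  next
    case 2
    then show ?thesis
      by (simp add: adjoint_power funpow_D_power_mult[OF g])
  next
    case 3
    then show ?thesis
      by (intro herm_homog[OF homog_power_mult[OF f(2)] homog_power_mult[OF g(2)]])
  qed
qed

section \<open>Existence of decompositions\<close>

lemma decomposition:
  assumes "f \<in> homog N"
  shows "\<exists>h. (\<forall>l\<le>N div 2. h l \<in> Ker D \<inter> homog (N - 2 * l)) \<and> f = (\<Sum>l\<le>N div 2. q ^ l * h l)"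
  using assms
proof (induction N arbitrary: f rule: less_induct)
  case (less N)
  show ?case
  proof (cases "N < 2")
    case True
    \<comment> \<open>Here \<open>N div 2 = 0\<close>, so the sum consists of the single term
      \<open>f\<close>.\<close>
    then show ?thesis
      using less.prems D_low[OF less.prems] by (intro exI[of _ "\<lambda>_. f"]) (auto simp: Ker_def)
  next
    case False
    define M where "M = N - 2"
    have N: "N = M + 2" and N2: "N div 2 = Suc (M div 2)"
      using False by (simp_all add: M_def)
    have "D f \<in> homog M"
      using homog_D[OF less.prems] by (simp add: M_def)
    then obtain h where h: "\<And>l. l \<le> M div 2 \<Longrightarrow> h l \<in> Ker D \<inter> homog (M - 2 * l)"
      and Df: "D f = (\<Sum>l\<le>M div 2. q ^ l * h l)"
      using less.IH[of M "D f"] N by auto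
    \<comment> \<open>By \<open>D_power_mult\<close> in degree \<open>M - 2 * l\<close>, applying
      \<open>D\<close> to \<open>q\<close> times \<open>q ^ l * h l\<close> gives \<open>s l\<close>
      times \<open>q ^ l * h l\<close>; this scalar is nonzero and is divided out in
      \<open>h'\<close>.\<close>
    define s where "s l = Suc l * (M - 2 * l + l + 2)" for l
    define h' where "h' l = Poly_Mapping.single 0 (inverse (of_nat (s l))) * h l" for l
    \<comment> \<open>Built as a multiple of \<open>q\<close> with \<open>D g = D f\<close>, so that
      \<open>f - g\<close> lies in the kernel.\<close>
    define g where "g = (\<Sum>l\<le>M div 2. q ^ Suc l * h' l)"
    have h': "D (h' l) = 0" "h' l \<in> homog (M - 2 * l)" if "l \<le> M div 2" for l
      using h[OF that] by (auto simp: h'_def Ker_def D_const_mult homog_const_mult)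
    have "D (q ^ Suc l * h' l) = q ^ l * h l" if "l \<le> M div 2" for l
    proof -
      have "s l \<noteq> 0"
        by (simp add: s_def)
      then have "of_nat (s l) * Poly_Mapping.single 0 (inverse (of_nat (s l))) = (1 :: cpoly)"
        by (simp add: mult_single flip: single_of_nat)
      moreover have "of_nat (s l) * (q ^ l * h' l) =
          of_nat (s l) * Poly_Mapping.single 0 (inverse (of_nat (s l))) * (q ^ l * h l)"
        by (simp only: h'_def mult.assoc mult.left_commute)
      ultimately have "of_nat (s l) * (q ^ l * h' l) = q ^ l * h l"
        by (simp only: mult_1_left)
      then show ?thesis
        using D_power_mult[OF h'[OF that], of l] by (simp only: s_def)
    qed
    then have "D g = D f"
      by (simp add: g_def D_sum Df)
    moreover have "q ^ Suc l * h' l \<in> homog N" if "l \<le> M div 2" for l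
    proof -
      have "M - 2 * l + 2 * Suc l = N"
        using that N by auto
      then show ?thesis
        using homog_power_mult[OF h'(2)[OF that], of "Suc l"] by metis
    qed
    then have "g \<in> homog N"
      unfolding g_def by (intro homog_sum) auto
    ultimately have k: "f - g \<in> Ker D \<inter> homog N"
      using less.prems by (simp add: Ker_def D_diff homog_diff)
    \<comment> \<open>The correction \<open>f - g\<close> is the component at 0; multiplication by
      \<open>q\<close> has shifted the others up by one index, and
      \<open>N - 2 * Suc l = M - 2 * l\<close>.\<close>
    let ?h = "\<lambda>l. case l of 0 \<Rightarrow> f - g | Suc l \<Rightarrow> h' l"
    have "f = (\<Sum>l\<le>N div 2. q ^ l * ?h l)"
      unfolding N2 sum.atMost_Suc_shift g_def by simp
    moreover have "\<forall>l\<le>N div 2. ?h l \<in> Ker D \<inter> homog (N - 2 * l)"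
      using k h' N by (auto simp: N2 Ker_def split: nat.split)
    ultimately show ?thesis
      by blast
  qed
qed

section \<open>The graded and the full direct sum\<close>

lemma component_add:
  assumes "f \<in> (\<lambda>f. q ^ l * f) ` (Ker D \<inter> homog N)" "g \<in> (\<lambda>f. q ^ l * f) ` (Ker D \<inter> homog N)"
  shows "f + g \<in> (\<lambda>f. q ^ l * f) ` (Ker D \<inter> homog N)"
proof -
  obtain u v where "u \<in> Ker D \<inter> homog N" "f = q ^ l * u" "v \<in> Ker D \<inter> homog N" "g = q ^ l * v"
    using assms by blast
  then show ?thesis
    by (intro image_eqI[of _ _ "u + v"]) (simp_all add: Ker_def D_add homog_add distrib_left)
qed

lemma component_diff:
  assumes "f \<in> (\<lambda>f. q ^ l * f) ` (Ker D \<inter> homog N)" "g \<in> (\<lambda>f. q ^ l * f) ` (Ker D \<inter> homog N)"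
  shows "f - g \<in> (\<lambda>f. q ^ l * f) ` (Ker D \<inter> homog N)"
proof -
  obtain u v where "u \<in> Ker D \<inter> homog N" "f = q ^ l * u" "v \<in> Ker D \<inter> homog N" "g = q ^ l * v"
    using assms by blast
  then show ?thesis
    by (intro image_eqI[of _ _ "u - v"]) (simp_all add: Ker_def D_diff homog_diff right_diff_distrib)
qed

lemma component_0: "0 \<in> (\<lambda>f. q ^ l * f) ` (Ker D \<inter> homog N)"
  by (rule image_eqI[of _ _ 0]) (auto simp: Ker_def homog_0)

lemma homog_direct_sum:
  "is_direct_sum (homog N) {0..N div 2} (\<lambda>l. (\<lambda>f. q ^ l * f) ` (Ker D \<inter> homog (N - 2 * l))) \<and>
   mutually_orthogonal {0..N div 2} (\<lambda>l. (\<lambda>f. q ^ l * f) ` (Ker D \<inter> homog (N - 2 * l)))"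
  (is "is_direct_sum _ ?K ?S \<and> _")
proof
  show orth: "mutually_orthogonal ?K ?S"
    \<comment> \<open>Distinct \<open>l\<close> give distinct pairs \<open>(N - 2 * l, l)\<close>,
      as \<open>orthogonal\<close> requires.\<close>
    unfolding mutually_orthogonal_def by (auto simp: Ker_def intro!: orthogonal)
  show "is_direct_sum (homog N) ?K ?S"
  proof (rule is_direct_sum_orthogonal[OF orth component_diff])
    show "family_sums ?K ?S = homog N"
    proof (intro equalityI subsetI)
      fix f
      assume "f \<in> family_sums ?K ?S"
      then obtain c where c: "c \<in> families ?K ?S" "f = (\<Sum>k | c k \<noteq> 0. c k)"
        by (auto simp: family_sums_def)
      have "c k \<in> homog N" if "c k \<noteq> 0" for k
      proof -
        have "k \<in> ?K" "c k \<in> ?S k"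
          using c(1) that by (auto simp: families_def)
        moreover from this have "N - 2 * k + 2 * k = N"
          by auto
        ultimately show ?thesis
          using homog_power_mult[of _ "N - 2 * k" k] by auto
      qed
      then show "f \<in> homog N"
        unfolding c(2) by (intro homog_sum) auto
    next
      fix f
      assume "f \<in> homog N"
      then obtain h where h: "\<And>l. l \<le> N div 2 \<Longrightarrow> h l \<in> Ker D \<inter> homog (N - 2 * l)"
        and f: "f = (\<Sum>l\<le>N div 2. q ^ l * h l)"
        using decomposition by blast
      show "f \<in> family_sums ?K ?S"
        unfolding f
      proof (rule family_sums_sum[OF _ component_add component_0])
        fix l
        assume "l \<in> {..N div 2}"
        then show "q ^ l * h l \<in> family_sums ?K ?S"
          using h by (intro family_sums_component[where k = l] component_0 imageI) auto
      qed
    qed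
  qed
qed

lemma UNIV_direct_sum:
  "is_direct_sum UNIV UNIV (\<lambda>(N, l). (\<lambda>f. q ^ l * f) ` (Ker D \<inter> homog N)) \<and>
   mutually_orthogonal UNIV (\<lambda>(N, l). (\<lambda>f. q ^ l * f) ` (Ker D \<inter> homog N))"
  (is "is_direct_sum _ ?K ?S \<and> _")
proof
  show orth: "mutually_orthogonal ?K ?S"
    unfolding mutually_orthogonal_def by (auto simp: Ker_def intro!: orthogonal)
  have S0: "0 \<in> ?S k" and S_add: "f \<in> ?S k \<Longrightarrow> g \<in> ?S k \<Longrightarrow> f + g \<in> ?S k"
    and S_diff: "f \<in> ?S k \<Longrightarrow> g \<in> ?S k \<Longrightarrow> f - g \<in> ?S k" for k f g
    by (cases k; simp only: prod.case component_0 component_add component_diff)+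
  have homog: "f \<in> family_sums ?K ?S" if N: "f \<in> homog N" for f N
  proof -
    obtain h where h: "\<And>l. l \<le> N div 2 \<Longrightarrow> h l \<in> Ker D \<inter> homog (N - 2 * l)"
      and f: "f = (\<Sum>l\<le>N div 2. q ^ l * h l)"
      using decomposition[OF N] by blast
    show ?thesis
      unfolding f
    proof (rule family_sums_sum[OF _ S_add S0])
      fix l
      assume "l \<in> {..N div 2}"
      then show "q ^ l * h l \<in> family_sums ?K ?S"
        \<comment> \<open>The first index is the degree of the kernel element, not of the product,
          hence the pair \<open>(N - 2 * l, l)\<close>.\<close>
        using h by (intro family_sums_component[where k = "(N - 2 * l, l)"] S0) auto
    qed
  qed
  have "f \<in> family_sums ?K ?S" for f
  proof -
    have "f = (\<Sum>m\<in>Poly_Mapping.keys f. Poly_Mapping.single m (Poly_Mapping.lookup f m))"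
      by (rule poly_mapping_eqI) (auto simp: lookup_sum lookup_single when_def in_keys_iff)
    also have "\<dots> \<in> family_sums ?K ?S"
    proof (rule family_sums_sum[OF _ S_add S0])
      fix m
      show "Poly_Mapping.single m (Poly_Mapping.lookup f m) \<in> family_sums ?K ?S"
        by (rule homog[of _ "mdeg m"]) (auto simp: homog_iff lookup_single when_def)
    qed
    finally show ?thesis .
  qed
  then show "is_direct_sum UNIV ?K ?S"
    by (intro is_direct_sum_orthogonal[OF orth S_diff]) auto
qed

end

section \<open>The three quadratic forms as one, up to permuting the variables\<close>

lemma raising_lowering_quadric:
  assumes vars: "distinct [a, b, c, d]"
  shows "raising_lowering (\<lambda>f. pdiff a (pdiff b f) - pdiff c (pdiff d f))
    (Var a * Var b - Var c * Var d)"
proof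
  fix f g :: cpoly and N :: nat and s :: complex
  let ?D = "\<lambda>f. pdiff a (pdiff b f) - pdiff c (pdiff d f)"
  let ?q = "Var a * Var b - Var c * Var d"
  show "?D (f + g) = ?D f + ?D g"
    by (simp add: pdiff_add)
  show "?D (Poly_Mapping.single 0 s * f) = Poly_Mapping.single 0 s * ?D f"
    by (simp add: pdiff_const_mult right_diff_distrib)
  have "herm (Var u * Var v * f) g = herm f (pdiff u (pdiff v g))" for u v
    by (metis herm_Var_mult mult.assoc mult.commute)
  then show "herm (?q * f) g = herm f (?D g)"
    by (simp add: left_diff_distrib herm_diff_left herm_diff_right)
  show "?D (?q * f) = ?q * ?D f + of_nat (N + 2) * f" if "f \<in> homog N"
  proof -
    \<comment> \<open>Four distinct variables exhaust the type, so Euler's identity runs over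
      exactly \<open>a\<close>, \<open>b\<close>, \<open>c\<close>, \<open>d\<close>.\<close>
    have "card {a, b, c, d} = card (UNIV :: var set)"
      using vars by (simp add: UNIV_var)
    then have U: "UNIV = {a, b, c, d}"
      by (metis card_subset_eq finite_var subset_UNIV)
    have "of_nat N * f = (\<Sum>v\<in>{a, b, c, d}. Var v * pdiff v f)"
      using euler[OF that] U by metis
    also have "\<dots> = Var a * pdiff a f + Var b * pdiff b f + Var c * pdiff c f + Var d * pdiff d f"
      using vars by (auto simp: add.assoc)
    moreover have "of_nat (N + 2) * f = of_nat N * f + f + f"
      by (simp only: of_nat_add distrib_right of_nat_numeral mult_2 add.assoc)
    ultimately have N2: "of_nat (N + 2) * f =
        Var a * pdiff a f + Var b * pdiff b f + Var c * pdiff c f + Var d * pdiff d f + f + f"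
      by (simp only:)
    \<comment> \<open>Each matching pair contributes two Euler terms and one extra \<open>f\<close>;
      the two pairs together give the full Euler sum and the 2 in \<open>N + 2\<close>.\<close>
    have same: "pdiff u (pdiff v (Var u * Var v * f)) =
        Var u * Var v * pdiff u (pdiff v f) + Var u * pdiff u f + Var v * pdiff v f + f"
      if "u \<noteq> v" for u v
      using that by (simp add: pdiff_Var_mult pdiff_add mult.assoc distrib_left)
    \<comment> \<open>No derivative meets its own variable here, so the mixed terms contribute only
      to \<open>?q * ?D f\<close>.\<close>
    have other: "pdiff u (pdiff v (Var s * Var t * f)) = Var s * Var t * pdiff u (pdiff v f)"
      if "distinct [u, v, s, t]" for u v s t
      using that by (auto simp: pdiff_Var_mult mult.assoc)
    have "?D (?q * f) = (pdiff a (pdiff b (Var a * Var b * f)) - pdiff a (pdiff b (Var c * Var d * f))) -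
        (pdiff c (pdiff d (Var a * Var b * f)) - pdiff c (pdiff d (Var c * Var d * f)))"
      by (simp only: left_diff_distrib pdiff_diff)
    moreover have "a \<noteq> b" "c \<noteq> d" "distinct [a, b, c, d]" "distinct [c, d, a, b]"
      using vars by auto
    ultimately have "?D (?q * f) =
        (Var a * Var b * pdiff a (pdiff b f) + Var a * pdiff a f + Var b * pdiff b f + f -
          Var c * Var d * pdiff a (pdiff b f)) -
        (Var a * Var b * pdiff c (pdiff d f) -
          (Var c * Var d * pdiff c (pdiff d f) + Var c * pdiff c f + Var d * pdiff d f + f))"
      by (simp only: same other not_False_eq_True)
    also have "\<dots> = ?q * ?D f + of_nat (N + 2) * f"
      unfolding N2 by (simp add: left_diff_distrib right_diff_distrib)
    finally show ?thesis .
  qed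
  have q: "Var u * Var v * f \<in> homog (N + 2)" if "f \<in> homog N" for u v
    using homog_Var_mult[OF homog_Var_mult[OF that]] by (simp add: mult.assoc)
  then show "?q * f \<in> homog (N + 2)" if "f \<in> homog N"
    using that by (simp add: left_diff_distrib homog_diff)
  have D: "pdiff u (pdiff v f) \<in> homog (N - 2)" if "f \<in> homog N" for u v
    using homog_pdiff[OF homog_pdiff[OF that]] by (simp add: numeral_2_eq_2)
  then show "?D f \<in> homog (N - 2)" if "f \<in> homog N"
    using that by (simp add: homog_diff)
  show "?D f = 0" if "f \<in> homog N" "N < 2"
  proof -
    have "pdiff v f \<in> homog 0" for v
      using homog_pdiff[OF that(1), of v] that(2) by (cases N) auto
    then show ?thesis
      by (simp add: pdiff_homog_0)
  qed
qed

theorem proposition13p18: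
  fixes i :: nat
  assumes "i \<in> {1, 2, 3}"
  shows
    "(is_direct_sum UNIV UNIV (\<lambda>(N, l). summand i N l) \<and>
      mutually_orthogonal UNIV (\<lambda>(N, l). summand i N l)) \<and>
     (\<forall>N. is_direct_sum (homog N) {0..N div 2} (\<lambda>l. summand i (N - 2 * l) l) \<and>
          mutually_orthogonal {0..N div 2} (\<lambda>l. summand i (N - 2 * l) l))"
proof -
  obtain a b c d where vars: "distinct [a, b, c, d]"
    and Li: "L i = (\<lambda>f. pdiff a (pdiff b f) - pdiff c (pdiff d f))"
    and Ri: "R i = (\<lambda>f. (Var a * Var b - Var c * Var d) * f)"
  proof -
    \<comment> \<open>The three indices are the three ways to split the four variables into two
      pairs.\<close>
    consider "i = 1" | "i = 2" | "i = 3"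
      using assms by auto
    then show ?thesis
    proof cases
      case 1
      then show ?thesis by (intro that[of X Y Z W] ext) (simp_all add: L_def R_def)
    next
      case 2
      then show ?thesis by (intro that[of X Z W Y] ext) (simp_all add: L_def R_def)
    next
      case 3
      then show ?thesis by (intro that[of X W Y Z] ext) (simp_all add: L_def R_def)
    qed
  qed
  let ?q = "Var a * Var b - Var c * Var d"
  interpret raising_lowering "L i" ?q
    unfolding Li by (rule raising_lowering_quadric[OF vars])
  have "(R i ^^ l) f = ?q ^ l * f" for l f
    by (induction l) (simp_all add: Ri mult.assoc)
  then have "summand i N l = (\<lambda>f. ?q ^ l * f) ` (Ker (L i) \<inter> homog N)" for N l
    by (simp add: summand_def)
  then show ?thesis
    using UNIV_direct_sum homog_direct_sum by simp
qed

end
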